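(* If $G$ is a graph and $p$ is a non-negative integer, then $$\gamma_g^{St,p}(G) \le \gamma_g(G) + p.$$
   Context: Graphs are finite and simple. A vertex $x$ dominates every vertex of its closed neighborhood $N[x]$ ($x$ together with its neighbors). The domination game on a graph $G$ is played by Dominator and Staller, who take turns choosing a vertex of $G$ such that at least one previously undominated vertex becomes dominated. The game is over when all vertices of $G$ are dominated. Dominator wants to minimize the number of vertices played, Staller wants to maximize it. In the D-game Dominator has the first move, and $\gamma_g(G)$ is the number of moves played in the D-game when both players play optimally. For a non-negative integer $p$, the Staller $p$-pass game on $G$ is a D-game in which Staller is allowed not to play, that is, to pass, at most $p$ times. The number of moves in the Staller $p$-pass game (the passes of Staller are not counted), when both players play optimally, is denoted $\gamma_g^{St,p}(G)$. *)

theory Defs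
  imports "Graph_Theory.Pair_Digraph"
begin

text \<open>A finite simple graph is a \<^locale>\<open>pair_graph\<close>: finitely many vertices and a symmetric,
  irreflexive set of arcs, an edge \<open>xy\<close> being represented by the two arcs \<open>(x, y)\<close> and \<open>(y, x)\<close>.\<close>

datatype player = Dominator | Staller

context pair_graph
begin

definition closed_nbhd :: "'a \<Rightarrow> 'a set" where
  "closed_nbhd x = insert x {y. x \<rightarrow>\<^bsub>G\<^esub> y}"

text \<open>A position of the game is described by the set \<open>D\<close> of vertices dominated so far. A vertex
  that has already been played dominates nothing new, so it is never legal again.\<close>

definition legal_moves :: "'a set \<Rightarrow> 'a set" where
  "legal_moves D = {x \<in> pverts G. \<not> closed_nbhd x \<subseteq> D}"

lemma finite_legal_moves: "finite (legal_moves D)"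
  unfolding legal_moves_def by simp

lemma legal_moves_nonempty:
  assumes "\<not> pverts G \<subseteq> D"
  shows "legal_moves D \<noteq> {}"
  using assms unfolding legal_moves_def closed_nbhd_def by auto

lemma undominated_decreases:
  assumes "x \<in> legal_moves D"
  shows "card (pverts G - (D \<union> closed_nbhd x)) < card (pverts G - D)"
proof (rule psubset_card_mono)
  show "finite (pverts G - D)" by simp
  have "closed_nbhd x \<subseteq> pverts G"
    using assms unfolding legal_moves_def closed_nbhd_def
    by (auto dest: in_arcsD2)
  then show "pverts G - (D \<union> closed_nbhd x) \<subset> pverts G - D"
    using assms unfolding legal_moves_def by auto
qed

text \<open>\<open>moves_left pl D\<close> is the number of moves still to be played under optimal play (the minimax
  value) when \<open>D\<close> is dominated and it is the turn of \<open>pl\<close>. Whenever \<open>Min\<close> and \<open>Max\<close> are taken,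
  \<open>legal_moves D\<close> is finite and nonempty.\<close>

function moves_left :: "player \<Rightarrow> 'a set \<Rightarrow> nat" where
  "moves_left Dominator D =
    (if pverts G \<subseteq> D then 0
     else Min ((\<lambda>x. Suc (moves_left Staller (D \<union> closed_nbhd x))) ` legal_moves D))"
| "moves_left Staller D =
    (if pverts G \<subseteq> D then 0
     else Max ((\<lambda>x. Suc (moves_left Dominator (D \<union> closed_nbhd x))) ` legal_moves D))"
  by pat_completeness auto
termination
  by (relation "measure (\<lambda>(pl, D). card (pverts G - D))") (auto intro: undominated_decreases)

definition game_domination_number :: nat where
  "game_domination_number = moves_left Dominator {}"

text \<open>\<open>pass_moves_left pl q D\<close> is the analogous value when Staller has \<open>q\<close> passes left. A pass
  hands the turn to Dominator in the same position and is not counted as a move.\<close>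

function pass_moves_left :: "player \<Rightarrow> nat \<Rightarrow> 'a set \<Rightarrow> nat" where
  "pass_moves_left Dominator q D =
    (if pverts G \<subseteq> D then 0
     else Min ((\<lambda>x. Suc (pass_moves_left Staller q (D \<union> closed_nbhd x))) ` legal_moves D))"
| "pass_moves_left Staller 0 D =
    (if pverts G \<subseteq> D then 0
     else Max ((\<lambda>x. Suc (pass_moves_left Dominator 0 (D \<union> closed_nbhd x))) ` legal_moves D))"
| "pass_moves_left Staller (Suc q) D =
    (if pverts G \<subseteq> D then 0
     else Max (insert (pass_moves_left Dominator q D)
       ((\<lambda>x. Suc (pass_moves_left Dominator (Suc q) (D \<union> closed_nbhd x))) ` legal_moves D)))"
  by pat_completeness auto
termination
  by (relation "measure (\<lambda>(pl, q, D). q + card (pverts G - D))")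
    (auto intro: undominated_decreases)

definition staller_pass_domination_number :: "nat \<Rightarrow> nat" where
  "staller_pass_domination_number p = pass_moves_left Dominator p {}"

end

end

theory Submission
  imports Defs
begin

text \<open>By the Continuation Principle, dominating more vertices never lengthens the game. So if
  Dominator moves out of turn, the game is prolonged by at most this one move; each pass of Staller
  therefore costs at most one move.\<close>

context pair_graph
begin

lemma legal_move_undominated:
  assumes "x \<in> legal_moves D"
  shows "\<not> pverts G \<subseteq> D"
  using undominated_decreases[OF assms] by (metis Diff_eq_empty_iff card.empty not_less_zero)

lemma legal_moves_antimono:
  assumes "D \<subseteq> D'"
  shows "legal_moves D' \<subseteq> legal_moves D"
  using assms unfolding legal_moves_def by blast

declare moves_left.simps [simp del] pass_moves_left.simps [simp del]

lemma moves_left_Dominator_le: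
  assumes "x \<in> legal_moves D"
  shows "moves_left Dominator D \<le> Suc (moves_left Staller (D \<union> closed_nbhd x))"
  using assms legal_move_undominated[OF assms]
  by (auto simp: moves_left.simps(1)[of D] finite_legal_moves intro!: Min_le)

lemma moves_left_Dominator_attained:
  assumes "\<not> pverts G \<subseteq> D"
  obtains x where "x \<in> legal_moves D"
    "moves_left Dominator D = Suc (moves_left Staller (D \<union> closed_nbhd x))"
proof -
  have "moves_left Dominator D
      \<in> (\<lambda>x. Suc (moves_left Staller (D \<union> closed_nbhd x))) ` legal_moves D"
    unfolding moves_left.simps(1)[of D] if_not_P[OF assms]
    by (rule Min_in) (use assms in \<open>simp_all add: finite_legal_moves legal_moves_nonempty\<close>)
  then show thesis using that by blast
qed

lemma moves_left_Staller_ge: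
  assumes "x \<in> legal_moves D"
  shows "Suc (moves_left Dominator (D \<union> closed_nbhd x)) \<le> moves_left Staller D"
  using assms legal_move_undominated[OF assms]
  by (auto simp: moves_left.simps(2)[of D] finite_legal_moves intro!: Max_ge)

lemma moves_left_Staller_le:
  assumes "\<And>x. x \<in> legal_moves D \<Longrightarrow> Suc (moves_left Dominator (D \<union> closed_nbhd x)) \<le> k"
  shows "moves_left Staller D \<le> k"
  using assms
  by (auto simp: moves_left.simps(2)[of D] finite_legal_moves legal_moves_nonempty)

text \<open>Strategy imitation, by induction on the number of vertices undominated in
  \<open>D\<close>: Dominator copies in \<open>D'\<close> an optimal move from \<open>D\<close>,
  while each Staller move legal in \<open>D'\<close> is already legal in \<open>D\<close>. Either
  way the inclusion between the two positions survives the move.\<close>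

theorem continuation_principle:
  assumes "D \<subseteq> D'"
  shows "moves_left pl D' \<le> moves_left pl D"
  using assms
proof (induction "card (pverts G - D)" arbitrary: pl D D' rule: less_induct)
  case less
  \<comment> \<open>The measure depends on the smaller set only, so the larger set \<open>E\<close>
    stays arbitrary. This matters because the move made in \<open>D'\<close> may differ from
    \<open>x\<close>.\<close>
  have IH: "moves_left pl' E \<le> moves_left pl' (D \<union> closed_nbhd x)"
    if "x \<in> legal_moves D" "D \<union> closed_nbhd x \<subseteq> E" for x E pl'
    using less.hyps undominated_decreases that by blast
  show ?case
  proof (cases pl)
    case Dominator
    show ?thesis
    proof (cases "pverts G \<subseteq> D'")
      case True
      then show ?thesis by (simp add: Dominator moves_left.simps(1)[of D'])
    next
      case False
      with less.prems have "\<not> pverts G \<subseteq> D" by blast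
      then obtain x where x: "x \<in> legal_moves D"
        "moves_left Dominator D = Suc (moves_left Staller (D \<union> closed_nbhd x))"
        by (rule moves_left_Dominator_attained)
      \<comment> \<open>Dominator imitates the optimal move \<open>x\<close>; if it is illegal in \<open>D'\<close>, then \<open>D'\<close> already
        contains everything it would dominate and any legal move will do.\<close>
      obtain y where y: "y \<in> legal_moves D'" "D \<union> closed_nbhd x \<subseteq> D' \<union> closed_nbhd y"
      proof (cases "x \<in> legal_moves D'")
        case True
        then show ?thesis using that less.prems by blast
      next
        case illegal: False
        with x(1) have "closed_nbhd x \<subseteq> D'" by (auto simp: legal_moves_def)
        moreover obtain y where "y \<in> legal_moves D'"
          using legal_moves_nonempty[OF False] by blast
        ultimately show ?thesis using that less.prems by blast
      qed
      have "moves_left Dominator D' \<le> Suc (moves_left Staller (D' \<union> closed_nbhd y))"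
        by (rule moves_left_Dominator_le[OF y(1)])
      also have "\<dots> \<le> moves_left Dominator D"
        using IH[OF x(1) y(2)] x(2) by simp
      finally show ?thesis by (simp add: Dominator)
    qed
  next
    case Staller
    have "moves_left Staller D' \<le> moves_left Staller D"
    proof (rule moves_left_Staller_le)
      fix x assume "x \<in> legal_moves D'"
      then have x: "x \<in> legal_moves D" using legal_moves_antimono less.prems by blast
      have "Suc (moves_left Dominator (D' \<union> closed_nbhd x))
          \<le> Suc (moves_left Dominator (D \<union> closed_nbhd x))"
        using IH[OF x] less.prems by (simp add: le_supI1)
      also have "\<dots> \<le> moves_left Staller D"
        by (rule moves_left_Staller_ge[OF x])
      finally show "Suc (moves_left Dominator (D' \<union> closed_nbhd x)) \<le> moves_left Staller D" .
    qed
    then show ?thesis by (simp add: Staller)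
  qed
qed

text \<open>This is the price of one pass: Dominator spends one move on any legal vertex, and by
  continuation the extra dominated vertices cannot lengthen what Staller faces next.\<close>

lemma moves_left_Dominator_le_Suc_Staller:
  "moves_left Dominator D \<le> Suc (moves_left Staller D)"
proof (cases "pverts G \<subseteq> D")
  case True
  then show ?thesis by (simp add: moves_left.simps(1)[of D])
next
  case False
  then obtain x where "x \<in> legal_moves D" using legal_moves_nonempty by blast
  then have "moves_left Dominator D \<le> Suc (moves_left Staller (D \<union> closed_nbhd x))"
    by (rule moves_left_Dominator_le)
  also have "\<dots> \<le> Suc (moves_left Staller D)"
    by (simp add: continuation_principle)
  finally show ?thesis .
qed

text \<open>Stated for both players and all positions so that induction along the recursion of the
  pass game applies.\<close>

lemma pass_moves_left_le: "pass_moves_left pl q D \<le> moves_left pl D + q"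
proof (induction pl q D rule: pass_moves_left.induct)
  case (1 q D)
  show ?case
  proof (cases "pverts G \<subseteq> D")
    case True
    then show ?thesis by (simp add: pass_moves_left.simps)
  next
    case False
    then obtain x where x: "x \<in> legal_moves D"
      "moves_left Dominator D = Suc (moves_left Staller (D \<union> closed_nbhd x))"
      by (rule moves_left_Dominator_attained)
    \<comment> \<open>The move \<open>x\<close>, optimal without passes, is one candidate in the
      minimum of the pass game.\<close>
    have "pass_moves_left Dominator q D
        \<le> Suc (pass_moves_left Staller q (D \<union> closed_nbhd x))"
      using False x(1)
      by (auto simp: pass_moves_left.simps(1)[of q D] finite_legal_moves intro!: Min_le)
    also have "\<dots> \<le> moves_left Dominator D + q"
      using 1[OF False x(1)] x(2) by simp
    finally show ?thesis .
  qed
next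
  case (2 D)
  have "Suc (pass_moves_left Dominator 0 (D \<union> closed_nbhd x)) \<le> moves_left Staller D"
    if "x \<in> legal_moves D" for x
    using 2[OF legal_move_undominated[OF that] that] moves_left_Staller_ge[OF that] by simp
  then show ?case
    by (auto simp: pass_moves_left.simps(2)[of D] finite_legal_moves legal_moves_nonempty)
next
  case (3 q D)
  have "Suc (pass_moves_left Dominator (Suc q) (D \<union> closed_nbhd x))
      \<le> moves_left Staller D + Suc q" if "x \<in> legal_moves D" for x
    using 3(2)[OF legal_move_undominated[OF that] that] moves_left_Staller_ge[OF that] by simp
  \<comment> \<open>After a pass only \<open>q\<close> passes remain, so the induction hypothesis
    adds \<open>q\<close>; the one move lost by handing over the turn accounts for the
    \<open>Suc\<close>.\<close>
  moreover have "pass_moves_left Dominator q D \<le> moves_left Staller D + Suc q"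
    if "\<not> pverts G \<subseteq> D"
    using 3(1)[OF that] moves_left_Dominator_le_Suc_Staller[of D] by simp
  ultimately show ?case
    by (auto simp: pass_moves_left.simps(3)[of q D] finite_legal_moves)
qed

end

theorem lemma2p3:
  fixes G :: "'a pair_pre_digraph" and p :: nat
  assumes "pair_graph G"
  shows "pair_graph.staller_pass_domination_number G p
    \<le> pair_graph.game_domination_number G + p"
proof -
  interpret pair_graph G by (fact assms)
  show ?thesis
    unfolding staller_pass_domination_number_def game_domination_number_def
    by (rule pass_moves_left_le)
qed

end
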